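(* Let $t,m$ be positive integers and let $\mathcal{I}$ be a nonempty finite set of $(1,1)$- or $(2,1)$-intervals of $\mathbb{R}^2$. Let $\mathcal{D}\subset\mathbb{R}^{6m}$ be the set of all vectors $\mathbb{v}_{\mathcal{J}}$, where $\mathcal{J}$ ranges over ordered $m$-tuples of $(1,1)$- or $(2,1)$-intervals of $\mathbb{R}^2$. Then the loss function $$\mathcal{L}_{\hat d_{\mathrm{E}},m}:\mathcal{D}\to\mathbb{R},\qquad \mathbb{v}_{\mathcal{J}}\mapsto t\cdot\hat d(\mathcal{I},\mathcal{J}),$$ is differentiable almost everywhere.
   Context: $\mathbb{R}^2$ carries the product partial order. An interval of $\mathbb{R}^2$ is a nonempty subset $I$ that is convex ($p,q\in I$, $p\le r\le q$ imply $r\in I$) and connected (any two elements are joined by a finite sequence in $I$ whose consecutive terms are comparable). $\min(I)$ and $\max(I)$ are the sets of minimal and maximal elements of $I$. A $(p,q)$-interval is an interval with exactly $p$ minimal points and exactly $q$ maximal points, and it is understood to be determined by them: $I=\{z\in\mathbb{R}^2:\exists u\in\min(I),\exists v\in\max(I),\ u\le z\le v\}$. For $\epsilon\ge0$, $I^\epsilon=\{q\in\mathbb{R}^2:\exists p\in I,\ \|p-q\|_\infty\le\epsilon\}$. An $\epsilon$-correspondence between nonempty sets of intervals $\mathcal{I},\mathcal{J}$ is a subset $\mathcal{R}\subset\mathcal{I}\times\mathcal{J}$ with surjective projections to both factors such that $J\subset I^\epsilon$ and $I\subset J^\epsilon$ for all $(I,J)\in\mathcal{R}$. Define $\hat d(\mathcal{I},\mathcal{J}):=\inf\{\epsilon>0:\text{there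 exists an }\epsilon\text{-correspondence between }\mathcal{I}\text{ and }\mathcal{J}\}$; for a tuple $\mathcal{J}$ this refers to its underlying set of intervals. The embedding $\mathbf{v}_I=(x,y,a,b,c,d)\in\mathbb{R}^6$: a $(2,1)$-interval with minimal points $(\xi_1,\eta_1),(\xi_2,\eta_2)$, $\xi_1<\xi_2$, $\eta_1>\eta_2$, and maximal point $(X,Y)$ has $\mathbf{v}_I=(\xi_2,\ \eta_1,\ Y-\eta_1,\ \xi_2-\xi_1,\ \eta_1-\eta_2,\ X-\xi_2)$; thus its minimal points are $(x-b,y)$ and $(x,y-c)$ and its maximal point is $(x+d,y+a)$. A $(1,1)$-interval with minimal point $(\xi,\eta)$ and maximal point $(X,Y)$ has $\mathbf{v}_I=(\xi,\eta,Y-\eta,0,0,X-\xi)$. For $\mathcal{J}=(J_1,\dots,J_m)$, $\mathbb{v}_{\mathcal{J}}=(\mathbf{v}_{J_1}|\cdots|\mathbf{v}_{J_m})\in\mathbb{R}^{6m}$ is the concatenation; $\mathbf{v}$, hence $\mathbb{v}$, is injective, so the loss function is well defined. "Almost everywhere" is with respect to Lebesgue measure on $\mathbb{R}^{6m}$. *)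

theory Defs
  imports "HOL-Analysis.Analysis"
begin

(* The order on real \<times> real is the componentwise one of HOL-Library.Product_Order. *)

type_synonym plane = "real \<times> real"

definition order_convex :: "'a::order set \<Rightarrow> bool" where
  "order_convex I \<longleftrightarrow> (\<forall>p\<in>I. \<forall>q\<in>I. \<forall>r. p \<le> r \<and> r \<le> q \<longrightarrow> r \<in> I)"

definition order_connected :: "'a::order set \<Rightarrow> bool" where
  "order_connected I \<longleftrightarrow>
     (\<forall>p\<in>I. \<forall>q\<in>I. (p, q) \<in> {(x, y). x \<in> I \<and> y \<in> I \<and> (x \<le> y \<or> y \<le> x)}\<^sup>*)"

definition poset_interval :: "'a::order set \<Rightarrow> bool" where
  "poset_interval I \<longleftrightarrow> I \<noteq> {} \<and> order_convex I \<and> order_connected I"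

definition minimal_points :: "'a::order set \<Rightarrow> 'a set" where
  "minimal_points I = {p \<in> I. \<forall>q\<in>I. q \<le> p \<longrightarrow> q = p}"

definition maximal_points :: "'a::order set \<Rightarrow> 'a set" where
  "maximal_points I = {p \<in> I. \<forall>q\<in>I. p \<le> q \<longrightarrow> q = p}"

definition pq_interval :: "nat \<Rightarrow> nat \<Rightarrow> plane set \<Rightarrow> bool" where
  "pq_interval p q I \<longleftrightarrow> poset_interval I
     \<and> finite (minimal_points I) \<and> card (minimal_points I) = p
     \<and> finite (maximal_points I) \<and> card (maximal_points I) = q
     \<and> I = {z. \<exists>u\<in>minimal_points I. \<exists>v\<in>maximal_points I. u \<le> z \<and> z \<le> v}"

definition small_interval :: "plane set \<Rightarrow> bool" where
  "small_interval I \<longleftrightarrow> pq_interval 1 1 I \<or> pq_interval 2 1 I"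

definition thickening :: "real \<Rightarrow> plane set \<Rightarrow> plane set" where
  "thickening \<epsilon> I = {q. \<exists>p\<in>I. infnorm (p - q) \<le> \<epsilon>}"

definition eps_correspondence ::
  "real \<Rightarrow> plane set set \<Rightarrow> plane set set \<Rightarrow> (plane set \<times> plane set) set \<Rightarrow> bool" where
  "eps_correspondence \<epsilon> \<I> \<J> R \<longleftrightarrow>
     R \<subseteq> \<I> \<times> \<J> \<and> fst ` R = \<I> \<and> snd ` R = \<J>
     \<and> (\<forall>(I, J)\<in>R. J \<subseteq> thickening \<epsilon> I \<and> I \<subseteq> thickening \<epsilon> J)"

(* The infimum is taken in the reals. For nonempty finite sets of (1,1)- and (2,1)-intervals,
   which are bounded, the set of admissible \<epsilon> is nonempty. *)
definition dhat :: "plane set set \<Rightarrow> plane set set \<Rightarrow> real" where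
  "dhat \<I> \<J> = Inf {\<epsilon>. \<epsilon> > 0 \<and> (\<exists>R. eps_correspondence \<epsilon> \<I> \<J> R)}"

definition embed_interval :: "plane set \<Rightarrow> real ^ 6" where
  "embed_interval I = (THE v.
     (pq_interval 2 1 I \<and>
       (\<exists>\<xi>\<^sub>1 \<eta>\<^sub>1 \<xi>\<^sub>2 \<eta>\<^sub>2 X Y.
          minimal_points I = {(\<xi>\<^sub>1, \<eta>\<^sub>1), (\<xi>\<^sub>2, \<eta>\<^sub>2)} \<and> \<xi>\<^sub>1 < \<xi>\<^sub>2 \<and> \<eta>\<^sub>1 > \<eta>\<^sub>2
          \<and> maximal_points I = {(X, Y)}
          \<and> v = vector [\<xi>\<^sub>2, \<eta>\<^sub>1, Y - \<eta>\<^sub>1, \<xi>\<^sub>2 - \<xi>\<^sub>1, \<eta>\<^sub>1 - \<eta>\<^sub>2, X - \<xi>\<^sub>2]))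
     \<or> (pq_interval 1 1 I \<and>
       (\<exists>\<xi> \<eta> X Y.
          minimal_points I = {(\<xi>, \<eta>)} \<and> maximal_points I = {(X, Y)}
          \<and> v = vector [\<xi>, \<eta>, Y - \<eta>, 0, 0, X - \<xi>])))"

(* An m-tuple is a function on a finite index type 'm with CARD('m) = m. The index type 'm \<times> 6 of
   the concatenated vector has 6 m elements; coordinate (i, k) is the k-th entry of block i. *)
definition embed_tuple :: "('m::finite \<Rightarrow> plane set) \<Rightarrow> real ^ ('m \<times> 6)" where
  "embed_tuple J = (\<chi> ik. embed_interval (J (fst ik)) $ snd ik)"

definition interval_tuples :: "('m::finite \<Rightarrow> plane set) set" where
  "interval_tuples = {J. \<forall>i. small_interval (J i)}"

definition loss_domain :: "(real ^ ('m::finite \<times> 6)) set" where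
  "loss_domain = embed_tuple ` interval_tuples"

(* Outside loss_domain the value is irrelevant; see loss_embed_tuple below. *)
definition loss :: "nat \<Rightarrow> plane set set \<Rightarrow> real ^ ('m::finite \<times> 6) \<Rightarrow> real" where
  "loss t \<I> v = real t * dhat \<I> (range (inv_into interval_tuples embed_tuple v))"

lemma infnorm_plane: "infnorm (p :: plane) = max \<bar>fst p\<bar> \<bar>snd p\<bar>"
proof -
  have "(\<lambda>i. \<bar>p \<bullet> i\<bar>) ` Basis = {\<bar>fst p\<bar>, \<bar>snd p\<bar>}"
    by (auto simp: Basis_prod_def inner_prod_def image_iff)
  then show ?thesis
    by (simp add: infnorm_Max)
qed

lemma vector_6:
  fixes x y a b c d :: "'a::zero"
  defines "v \<equiv> vector [x, y, a, b, c, d] :: 'a ^ 6"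
  shows "v $ 1 = x" "v $ 2 = y" "v $ 3 = a" "v $ 4 = b" "v $ 5 = c" "v $ 6 = d"
  unfolding v_def vector_def by simp_all

lemma vector_6_eq_iff:
  "(vector [x, y, a, b, c, d] :: 'a::zero ^ 6) = vector [x', y', a', b', c', d'] \<longleftrightarrow>
     x = x' \<and> y = y' \<and> a = a' \<and> b = b' \<and> c = c' \<and> d = d'"
  (is "?v = ?w \<longleftrightarrow> _")
proof
  assume eq: "?v = ?w"
  have "?v $ k = ?w $ k" for k
    by (simp only: eq)
  from this[of 1] this[of 2] this[of 3] this[of 4] this[of 5] this[of 6]
  show "x = x' \<and> y = y' \<and> a = a' \<and> b = b' \<and> c = c' \<and> d = d'"
    by (simp only: vector_6)
qed simp

lemma embed_interval_21:
  assumes "pq_interval 2 1 I" "minimal_points I = {(\<xi>\<^sub>1, \<eta>\<^sub>1), (\<xi>\<^sub>2, \<eta>\<^sub>2)}" "\<xi>\<^sub>1 < \<xi>\<^sub>2" "\<eta>\<^sub>1 > \<eta>\<^sub>2"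
    "maximal_points I = {(X, Y)}"
  shows "embed_interval I = vector [\<xi>\<^sub>2, \<eta>\<^sub>1, Y - \<eta>\<^sub>1, \<xi>\<^sub>2 - \<xi>\<^sub>1, \<eta>\<^sub>1 - \<eta>\<^sub>2, X - \<xi>\<^sub>2]"
proof -
  have "\<not> pq_interval 1 1 I"
    using assms(1) by (simp add: pq_interval_def)
  then show ?thesis
    unfolding embed_interval_def using assms
    by (intro the_equality) (auto simp: doubleton_eq_iff)
qed

lemma embed_interval_11:
  assumes "pq_interval 1 1 I" "minimal_points I = {(\<xi>, \<eta>)}" "maximal_points I = {(X, Y)}"
  shows "embed_interval I = vector [\<xi>, \<eta>, Y - \<eta>, 0, 0, X - \<xi>]"
proof -
  have "\<not> pq_interval 2 1 I"
    using assms(1) by (simp add: pq_interval_def)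
  then show ?thesis
    unfolding embed_interval_def using assms
    by (intro the_equality) auto
qed

lemma pq_interval_21_cases:
  assumes "pq_interval 2 1 I"
  obtains \<xi>\<^sub>1 \<eta>\<^sub>1 \<xi>\<^sub>2 \<eta>\<^sub>2 X Y where
    "minimal_points I = {(\<xi>\<^sub>1, \<eta>\<^sub>1), (\<xi>\<^sub>2, \<eta>\<^sub>2)}" "\<xi>\<^sub>1 < \<xi>\<^sub>2" "\<eta>\<^sub>1 > \<eta>\<^sub>2" "maximal_points I = {(X, Y)}"
proof -
  obtain u w where uw: "minimal_points I = {u, w}" "u \<noteq> w"
    using assms by (auto simp: pq_interval_def card_2_iff)
  obtain v where v: "maximal_points I = {v}"
    using assms by (auto simp: pq_interval_def card_1_singleton_iff)
  have "u \<in> minimal_points I" "w \<in> minimal_points I"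
    using uw by auto
  then have nc: "\<not> u \<le> w" "\<not> w \<le> u"
    using uw(2) by (auto simp: minimal_points_def)
  show thesis
  proof (cases "fst u < fst w")
    case True
    with nc have "snd u > snd w"
      by (auto simp: less_eq_prod_def)
    with True uw v show thesis
      by (intro that[of "fst u" "snd u" "fst w" "snd w" "fst v" "snd v"]) auto
  next
    case False
    with nc have "fst w < fst u" "snd w > snd u"
      by (auto simp: less_eq_prod_def)
    with uw v show thesis
      by (intro that[of "fst w" "snd w" "fst u" "snd u" "fst v" "snd v"]) auto
  qed
qed

lemma pq_interval_11_cases:
  assumes "pq_interval 1 1 I"
  obtains \<xi> \<eta> X Y where "minimal_points I = {(\<xi>, \<eta>)}" "maximal_points I = {(X, Y)}"
  using assms by (auto simp: pq_interval_def card_1_singleton_iff)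

lemma inj_on_embed_interval: "inj_on embed_interval {I. small_interval I}"
proof (rule inj_onI)
  fix I I' assume "I \<in> {I. small_interval I}" "I' \<in> {I. small_interval I}"
    and eq: "embed_interval I = embed_interval I'"
  then consider "pq_interval 1 1 I" "pq_interval 1 1 I'" | "pq_interval 1 1 I" "pq_interval 2 1 I'"
    | "pq_interval 2 1 I" "pq_interval 1 1 I'" | "pq_interval 2 1 I" "pq_interval 2 1 I'"
    by (auto simp: small_interval_def)
  then have "minimal_points I = minimal_points I' \<and> maximal_points I = maximal_points I'"
  proof cases
    case 1
    obtain a b X Y where 2: "minimal_points I = {(a, b)}" "maximal_points I = {(X, Y)}"
      using pq_interval_11_cases[OF 1(1)] .
    obtain a' b' X' Y' where 3: "minimal_points I' = {(a', b')}" "maximal_points I' = {(X', Y')}"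
      using pq_interval_11_cases[OF 1(2)] .
    show ?thesis
      using eq unfolding embed_interval_11[OF 1(1) 2] embed_interval_11[OF 1(2) 3]
      by (auto simp: vector_6_eq_iff 2 3)
  next
    case 2
    obtain a b X Y where m: "minimal_points I = {(a, b)}" "maximal_points I = {(X, Y)}"
      using pq_interval_11_cases[OF 2(1)] .
    obtain a' b' c' d' X' Y' where n: "minimal_points I' = {(a', b'), (c', d')}" "a' < c'" "b' > d'"
      "maximal_points I' = {(X', Y')}"
      using pq_interval_21_cases[OF 2(2)] .
    show ?thesis
      using eq n(2) unfolding embed_interval_11[OF 2(1) m] embed_interval_21[OF 2(2) n]
      by (auto simp: vector_6_eq_iff)
  next
    case 3
    obtain a b X Y where m: "minimal_points I' = {(a, b)}" "maximal_points I' = {(X, Y)}"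
      using pq_interval_11_cases[OF 3(2)] .
    obtain a' b' c' d' X' Y' where n: "minimal_points I = {(a', b'), (c', d')}" "a' < c'" "b' > d'"
      "maximal_points I = {(X', Y')}"
      using pq_interval_21_cases[OF 3(1)] .
    show ?thesis
      using eq n(2) unfolding embed_interval_11[OF 3(2) m] embed_interval_21[OF 3(1) n]
      by (auto simp: vector_6_eq_iff)
  next
    case 4
    obtain a b c d X Y where 2: "minimal_points I = {(a, b), (c, d)}" "a < c" "b > d"
      "maximal_points I = {(X, Y)}"
      using pq_interval_21_cases[OF 4(1)] .
    obtain a' b' c' d' X' Y' where 3: "minimal_points I' = {(a', b'), (c', d')}" "a' < c'" "b' > d'"
      "maximal_points I' = {(X', Y')}"
      using pq_interval_21_cases[OF 4(2)] .
    show ?thesis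
      using eq unfolding embed_interval_21[OF 4(1) 2] embed_interval_21[OF 4(2) 3]
      by (auto simp: vector_6_eq_iff 2 3)
  qed
  then have mm: "minimal_points I = minimal_points I'" "maximal_points I = maximal_points I'"
    by auto
  have span: "J = {z. \<exists>u\<in>minimal_points J. \<exists>v\<in>maximal_points J. u \<le> z \<and> z \<le> v}"
    if "J \<in> {I. small_interval I}" for J
    using that unfolding small_interval_def pq_interval_def by blast
  show "I = I'"
    by (subst span[OF \<open>I \<in> _\<close>], subst span[OF \<open>I' \<in> _\<close>]) (simp only: mm)
qed

lemma inj_on_embed_tuple: "inj_on embed_tuple interval_tuples"
proof (rule inj_onI, rule ext)
  fix J J' :: "'m::finite \<Rightarrow> plane set" and i
  assume J: "J \<in> interval_tuples" "J' \<in> interval_tuples" and eq: "embed_tuple J = embed_tuple J'"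
  have "embed_interval (J i) $ k = embed_interval (J' i) $ k" for k
    using arg_cong[OF eq, of "\<lambda>v. v $ (i, k)"] by (simp add: embed_tuple_def)
  then have "embed_interval (J i) = embed_interval (J' i)"
    by (simp add: vec_eq_iff)
  moreover have "J i \<in> {I. small_interval I}" "J' i \<in> {I. small_interval I}"
    using J by (simp_all add: interval_tuples_def)
  ultimately show "J i = J' i"
    by (rule inj_onD[OF inj_on_embed_interval])
qed

lemma loss_embed_tuple:
  "J \<in> interval_tuples \<Longrightarrow> loss t \<I> (embed_tuple J) = real t * dhat \<I> (range J)"
  by (simp add: loss_def inj_on_embed_tuple)

end

theory Submission
  imports Defs
begin

text \<open>
  The loss is, on its domain, the restriction of a continuous function on the whole space that at
  every point takes the value of one of finitely many affine functions. Such a function is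
  differentiable off a finite union of hyperplanes (\<open>piecewise_affine_AE_differentiable\<close>): where
  the affine functions that are not identical have pairwise different values, continuity forces
  the function to follow a single one of them on a neighbourhood. Differentiability passes to the
  loss because a function that agrees on a set with a differentiable one is differentiable within
  that set.

  To see that the loss has this form, observe that, for \<open>\<epsilon> \<ge> 0\<close>, a (1,1)- or (2,1)-interval is contained
  in the \<open>\<epsilon>\<close>-thickening of another one if and only if a finite combination, by conjunctions and
  disjunctions, of inequalities \<open>s - s' \<le> \<epsilon>\<close> between coordinates of minimal and maximal points holds
  (\<open>staircase_subset_thickening_iff\<close>). These coordinates are linear in the embedding vector, by one
  formula for both kinds of intervals: a (1,1)-interval is treated as a (2,1)-interval whose two
  minimal points coincide (\<open>small_interval_shape\<close>). The existence of an \<open>\<epsilon>\<close>-correspondence between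
  finite sets is again a finite combination of such containments. Conjunction and
  disjunction of conditions \<open>f v \<le> \<epsilon>\<close> and \<open>g v \<le> \<epsilon>\<close> amount to taking the maximum and the minimum
  of \<open>f\<close> and \<open>g\<close>, which preserves continuous selections of affine functions. So, for
  positive \<open>\<epsilon>\<close>, an \<open>\<epsilon>\<close>-correspondence exists exactly when \<open>\<epsilon>\<close> is at least the value of such a function, and the
  infimum of the admissible positive \<open>\<epsilon>\<close> is the positive part of that value.
\<close>

section \<open>Continuous selections of finitely many affine functions\<close>

text \<open>
  Affine functions are given by their coefficients \<open>(c, k)\<close>, so that different members of \<open>C\<close>
  agree at most on a hyperplane. Which member applies at which point is left open; continuity
  alone ties the choices together, so closure under maxima and minima only requires taking the
  union of the two coefficient sets.
\<close>

definition piecewise_affine :: "('a::euclidean_space \<Rightarrow> real) \<Rightarrow> bool" where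
  "piecewise_affine f \<longleftrightarrow> continuous_on UNIV f \<and>
     (\<exists>C. finite C \<and> (\<forall>v. \<exists>(c, k)\<in>C. f v = c \<bullet> v + k))"

lemma piecewise_affine_const: "piecewise_affine (\<lambda>v. k)"
  unfolding piecewise_affine_def by (intro conjI continuous_intros exI[of _ "{(0, k)}"]) auto

lemma piecewise_affine_nth: "piecewise_affine (\<lambda>v :: real ^ 'n::finite. v $ i)"
  unfolding piecewise_affine_def
  by (intro conjI continuous_intros exI[of _ "{(axis i 1, 0)}"])
    (auto simp: inner_axis inner_commute[of "axis i 1"])

lemma piecewise_affine_add:
  assumes "piecewise_affine f" "piecewise_affine g"
  shows "piecewise_affine (\<lambda>v. f v + g v)"
proof -
  obtain C where C: "finite C" "\<And>v. \<exists>(c, k)\<in>C. f v = c \<bullet> v + k"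
    using assms(1) unfolding piecewise_affine_def by blast
  obtain D where D: "finite D" "\<And>v. \<exists>(c, k)\<in>D. g v = c \<bullet> v + k"
    using assms(2) unfolding piecewise_affine_def by blast
  have "\<exists>(c, k)\<in>(\<lambda>(p, q). p + q) ` (C \<times> D). f v + g v = c \<bullet> v + k" for v
  proof -
    obtain p q where "p \<in> C" "f v = fst p \<bullet> v + snd p" "q \<in> D" "g v = fst q \<bullet> v + snd q"
      using C(2)[of v] D(2)[of v] by auto
    then show ?thesis
      by (intro bexI[of _ "p + q"] image_eqI[of _ _ "(p, q)"])
        (auto simp: inner_add_left split_beta)
  qed
  then show ?thesis
    using assms C(1) D(1) unfolding piecewise_affine_def
    by (intro conjI continuous_intros exI[of _ "(\<lambda>(p, q). p + q) ` (C \<times> D)"]) auto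
qed

lemma piecewise_affine_uminus:
  assumes "piecewise_affine f"
  shows "piecewise_affine (\<lambda>v. - f v)"
proof -
  obtain C where C: "finite C" "\<And>v. \<exists>(c, k)\<in>C. f v = c \<bullet> v + k"
    using assms(1) unfolding piecewise_affine_def by blast
  have "\<exists>(c, k)\<in>uminus ` C. - f v = c \<bullet> v + k" for v
    using C(2)[of v] by force
  then show ?thesis
    using assms C(1) unfolding piecewise_affine_def
    by (intro conjI continuous_intros exI[of _ "uminus ` C"]) auto
qed

lemma piecewise_affine_diff:
  assumes "piecewise_affine f" "piecewise_affine g"
  shows "piecewise_affine (\<lambda>v. f v - g v)"
  using piecewise_affine_add[OF assms(1) piecewise_affine_uminus[OF assms(2)]] by simp

lemma piecewise_affine_selection:
  assumes "piecewise_affine f" "piecewise_affine g"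
    and "continuous_on UNIV h" and "\<And>v. h v = f v \<or> h v = g v"
  shows "piecewise_affine h"
proof -
  obtain C where C: "finite C" "\<And>v. \<exists>(c, k)\<in>C. f v = c \<bullet> v + k"
    using assms(1) unfolding piecewise_affine_def by blast
  obtain D where D: "finite D" "\<And>v. \<exists>(c, k)\<in>D. g v = c \<bullet> v + k"
    using assms(2) unfolding piecewise_affine_def by blast
  have "\<exists>(c, k)\<in>C \<union> D. h v = c \<bullet> v + k" for v
    using C(2)[of v] D(2)[of v] assms(4)[of v] by fastforce
  then show ?thesis
    using assms(3) C(1) D(1) unfolding piecewise_affine_def
    by (intro conjI exI[of _ "C \<union> D"]) auto
qed

lemma piecewise_affine_max:
  assumes "piecewise_affine f" "piecewise_affine g"
  shows "piecewise_affine (\<lambda>v. max (f v) (g v))"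
  using assms
  by (intro piecewise_affine_selection[OF assms] continuous_on_max)
    (auto simp: piecewise_affine_def max_def)

lemma piecewise_affine_min:
  assumes "piecewise_affine f" "piecewise_affine g"
  shows "piecewise_affine (\<lambda>v. min (f v) (g v))"
  using assms
  by (intro piecewise_affine_selection[OF assms] continuous_on_min)
    (auto simp: piecewise_affine_def min_def)

lemma negligible_UN:
  assumes "finite A" "\<And>x. x \<in> A \<Longrightarrow> negligible (H x)"
  shows "negligible (\<Union>x\<in>A. H x)"
proof (rule negligible_Union)
  show "finite (H ` A)"
    using assms(1) by simp
  show "negligible T" if "T \<in> H ` A" for T
    using that assms(2) by blast
qed

text \<open>
  The exceptional set is the union of the hyperplanes on which two different members of the
  selection have equal values. At any other point all members but one differ from \<open>f\<close>, by
  continuity they still do so nearby, and there \<open>f\<close> coincides with the remaining one.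
\<close>

lemma piecewise_affine_AE_differentiable:
  fixes f :: "'a::euclidean_space \<Rightarrow> real"
  assumes "piecewise_affine f"
  shows "AE v in lebesgue. f differentiable (at v)"
proof -
  obtain C where C: "finite C" "\<And>v. \<exists>(c, k)\<in>C. f v = c \<bullet> v + k"
    and cont: "continuous_on UNIV f"
    using assms unfolding piecewise_affine_def by blast
  define val where "val p v = fst p \<bullet> v + snd p" for p :: "'a \<times> real" and v
  define N where "N = (\<Union>p\<in>C. \<Union>q\<in>C - {p}. {v. val p v = val q v})"
  have hyperplane: "negligible {v. val p v = val q v}" if "p \<noteq> q" for p q
  proof -
    have "{v. val p v = val q v} = {v. (fst p - fst q) \<bullet> v = snd q - snd p}"
      by (auto simp: val_def inner_diff_left)
    moreover have "fst p - fst q \<noteq> 0 \<or> snd q - snd p \<noteq> 0"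
      using that by (auto simp: prod_eq_iff)
    ultimately show ?thesis
      using negligible_hyperplane by metis
  qed
  have inner: "negligible (\<Union>q\<in>C - {p}. {v. val p v = val q v})" for p
  proof (rule negligible_UN)
    show "finite (C - {p})"
      using C(1) by simp
    show "negligible {v. val p v = val q v}" if "q \<in> C - {p}" for q
      using that by (intro hyperplane) auto
  qed
  have "negligible N"
    unfolding N_def by (rule negligible_UN[OF C(1)]) (rule inner)
  then have "AE v in lebesgue. v \<notin> N"
    by (intro AE_not_in) (simp add: negligible_iff_null_sets)
  then show ?thesis
  proof eventually_elim
    case (elim v)
    obtain p where p: "p \<in> C" "f v = val p v"
      using C(2)[of v] by (auto simp: val_def)
    have "\<forall>\<^sub>F w in nhds v. f w \<noteq> val q w" if "q \<in> C - {p}" for q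
    proof -
      have "f v - val q v \<noteq> 0"
        using elim that p unfolding N_def by auto
      moreover have "isCont (\<lambda>w. f w - val q w) v"
        using cont unfolding val_def
        by (intro continuous_intros) (simp add: continuous_on_eq_continuous_at)
      ultimately have "\<forall>\<^sub>F w in nhds v. f w - val q w \<noteq> 0"
        using tendsto_at_iff_tendsto_nhds[of "\<lambda>w. f w - val q w" v]
        by (intro tendsto_imp_eventually_ne) (auto simp: isCont_def)
      then show ?thesis
        by simp
    qed
    then have "\<forall>\<^sub>F w in nhds v. \<forall>q\<in>C - {p}. f w \<noteq> val q w"
      using C(1) by (intro eventually_ball_finite) auto
    then have "\<forall>\<^sub>F w in nhds v. val p w = f w"
    proof eventually_elim
      case (elim w)
      obtain q where "q \<in> C" "f w = val q w"
        using C(2)[of w] by (auto simp: val_def)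
      with elim show ?case
        by auto
    qed
    then have ev: "\<forall>\<^sub>F w in at v. val p w = f w"
      by (auto simp: eventually_at_filter elim: eventually_mono)
    have "(val p has_derivative (\<lambda>w. fst p \<bullet> w)) (at v)"
      unfolding val_def by (auto intro!: derivative_eq_intros)
    then have "(f has_derivative (\<lambda>w. fst p \<bullet> w)) (at v)"
      by (rule has_derivative_transform_eventually[OF _ ev]) (simp_all add: p(2))
    then show ?case
      by (auto simp: differentiable_def)
  qed
qed

section \<open>Conditions with a piecewise affine threshold\<close>

definition affine_threshold :: "('a::euclidean_space \<Rightarrow> real \<Rightarrow> bool) \<Rightarrow> bool" where
  "affine_threshold P \<longleftrightarrow> (\<exists>f. piecewise_affine f \<and> (\<forall>v \<epsilon>. P v \<epsilon> \<longleftrightarrow> f v \<le> \<epsilon>))"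

lemma affine_threshold_le: "piecewise_affine f \<Longrightarrow> affine_threshold (\<lambda>v \<epsilon>. f v \<le> \<epsilon>)"
  unfolding affine_threshold_def by blast

lemma affine_threshold_conj:
  assumes "affine_threshold P" "affine_threshold Q"
  shows "affine_threshold (\<lambda>v \<epsilon>. P v \<epsilon> \<and> Q v \<epsilon>)"
proof -
  obtain f g where "piecewise_affine f" "\<forall>v \<epsilon>. P v \<epsilon> \<longleftrightarrow> f v \<le> \<epsilon>"
    "piecewise_affine g" "\<forall>v \<epsilon>. Q v \<epsilon> \<longleftrightarrow> g v \<le> \<epsilon>"
    using assms unfolding affine_threshold_def by blast
  then show ?thesis
    unfolding affine_threshold_def
    by (intro exI[of _ "\<lambda>v. max (f v) (g v)"]) (auto intro: piecewise_affine_max)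
qed

lemma affine_threshold_disj:
  assumes "affine_threshold P" "affine_threshold Q"
  shows "affine_threshold (\<lambda>v \<epsilon>. P v \<epsilon> \<or> Q v \<epsilon>)"
proof -
  obtain f g where "piecewise_affine f" "\<forall>v \<epsilon>. P v \<epsilon> \<longleftrightarrow> f v \<le> \<epsilon>"
    "piecewise_affine g" "\<forall>v \<epsilon>. Q v \<epsilon> \<longleftrightarrow> g v \<le> \<epsilon>"
    using assms unfolding affine_threshold_def by blast
  then show ?thesis
    unfolding affine_threshold_def
    by (intro exI[of _ "\<lambda>v. min (f v) (g v)"]) (auto intro: piecewise_affine_min simp: min_le_iff_disj)
qed

lemma affine_threshold_ball:
  assumes "finite A" "A \<noteq> {}" "\<And>x. x \<in> A \<Longrightarrow> affine_threshold (P x)"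
  shows "affine_threshold (\<lambda>v \<epsilon>. \<forall>x\<in>A. P x v \<epsilon>)"
  using assms by (induction A rule: finite_ne_induct) (auto intro: affine_threshold_conj)

lemma affine_threshold_bex:
  assumes "finite A" "A \<noteq> {}" "\<And>x. x \<in> A \<Longrightarrow> affine_threshold (P x)"
  shows "affine_threshold (\<lambda>v \<epsilon>. \<exists>x\<in>A. P x v \<epsilon>)"
  using assms by (induction A rule: finite_ne_induct) (auto intro: affine_threshold_disj)

section \<open>Containment of intervals in thickenings\<close>

definition staircase :: "plane set \<Rightarrow> plane \<Rightarrow> plane set" where
  "staircase M w = {z. \<exists>u\<in>M. u \<le> z \<and> z \<le> w}"

definition le_upto :: "real \<Rightarrow> plane \<Rightarrow> plane \<Rightarrow> bool" where
  "le_upto \<epsilon> p q \<longleftrightarrow> fst p - fst q \<le> \<epsilon> \<and> snd p - snd q \<le> \<epsilon>"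

text \<open>
  A point between \<open>u - (\<epsilon>, \<epsilon>)\<close> and \<open>w + (\<epsilon>, \<epsilon>)\<close> has distance at most \<open>\<epsilon>\<close> from its coordinatewise
  projection to the rectangle between \<open>u\<close> and \<open>w\<close>. The projection lies in the rectangle because
  \<open>u \<le> w\<close>.
\<close>

lemma thickening_staircase_iff:
  assumes "0 \<le> \<epsilon>" "\<And>u. u \<in> M \<Longrightarrow> u \<le> w"
  shows "q \<in> thickening \<epsilon> (staircase M w) \<longleftrightarrow> (\<exists>u\<in>M. le_upto \<epsilon> u q) \<and> le_upto \<epsilon> q w"
proof
  assume "q \<in> thickening \<epsilon> (staircase M w)"
  then obtain p u where "u \<in> M" "u \<le> p" "p \<le> w" "infnorm (p - q) \<le> \<epsilon>"
    unfolding thickening_def staircase_def by blast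
  then show "(\<exists>u\<in>M. le_upto \<epsilon> u q) \<and> le_upto \<epsilon> q w"
    by (intro conjI bexI[of _ u]) (auto simp: infnorm_plane le_upto_def less_eq_prod_def)
next
  assume "(\<exists>u\<in>M. le_upto \<epsilon> u q) \<and> le_upto \<epsilon> q w"
  then obtain u where u: "u \<in> M" "le_upto \<epsilon> u q" "le_upto \<epsilon> q w"
    by blast
  define p where
    "p = (max (fst u) (min (fst w) (fst q)), max (snd u) (min (snd w) (snd q)))"
  have "u \<le> w"
    using assms(2) u(1) .
  then have "u \<le> p" "p \<le> w" "infnorm (p - q) \<le> \<epsilon>"
    using u(2,3) assms(1)
    by (auto simp: p_def infnorm_plane le_upto_def less_eq_prod_def max_def min_def)
  then show "q \<in> thickening \<epsilon> (staircase M w)"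
    using u(1) unfolding thickening_def staircase_def by blast
qed

text \<open>
  The lower points of the smaller region and its top belong to it and are the extreme cases of
  \<open>thickening_staircase_iff\<close>, so it suffices to test them.
\<close>

lemma staircase_subset_thickening_iff:
  assumes "0 \<le> \<epsilon>" "\<And>u. u \<in> M \<Longrightarrow> u \<le> w" "\<And>u. u \<in> M' \<Longrightarrow> u \<le> w'" "M' \<noteq> {}"
  shows "staircase M' w' \<subseteq> thickening \<epsilon> (staircase M w) \<longleftrightarrow>
    (\<forall>u'\<in>M'. \<exists>u\<in>M. le_upto \<epsilon> u u') \<and> le_upto \<epsilon> w' w"
proof
  assume sub: "staircase M' w' \<subseteq> thickening \<epsilon> (staircase M w)"
  have "M' \<subseteq> staircase M' w'" "w' \<in> staircase M' w'"
    using assms(3,4) unfolding staircase_def by auto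
  with sub have "M' \<subseteq> thickening \<epsilon> (staircase M w)" "w' \<in> thickening \<epsilon> (staircase M w)"
    by auto
  then show "(\<forall>u'\<in>M'. \<exists>u\<in>M. le_upto \<epsilon> u u') \<and> le_upto \<epsilon> w' w"
    using thickening_staircase_iff[of \<epsilon> M w, OF assms(1,2)] by blast
next
  assume R: "(\<forall>u'\<in>M'. \<exists>u\<in>M. le_upto \<epsilon> u u') \<and> le_upto \<epsilon> w' w"
  show "staircase M' w' \<subseteq> thickening \<epsilon> (staircase M w)"
  proof
    fix z assume "z \<in> staircase M' w'"
    then obtain u' where u': "u' \<in> M'" "u' \<le> z" "z \<le> w'"
      unfolding staircase_def by blast
    with R obtain u where u: "u \<in> M" "le_upto \<epsilon> u u'"
      by blast
    have "le_upto \<epsilon> u z" "le_upto \<epsilon> z w"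
      using u(2) u'(2,3) R by (auto simp: le_upto_def less_eq_prod_def)
    with u(1) show "z \<in> thickening \<epsilon> (staircase M w)"
      using thickening_staircase_iff[of \<epsilon> M w, OF assms(1,2)] by blast
  qed
qed

section \<open>Reconstructing an interval from its embedding vector\<close>

definition lower_points :: "real ^ 6 \<Rightarrow> plane set" where
  "lower_points v = {(v $ 1 - v $ 4, v $ 2), (v $ 1, v $ 2 - v $ 5)}"

definition upper_point :: "real ^ 6 \<Rightarrow> plane" where
  "upper_point v = (v $ 1 + v $ 6, v $ 2 + v $ 3)"

text \<open>
  The coordinates are \<open>(x, y, a, b, c, d)\<close>, so the lower points are \<open>(x - b, y)\<close> and \<open>(x, y - c)\<close>
  and the upper point is \<open>(x + d, y + a)\<close>. For a (1,1)-interval \<open>b\<close> and \<open>c\<close> vanish, so that both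
  lower points are its unique minimal point.
\<close>

lemma small_interval_shape:
  assumes "small_interval I"
  shows "I = staircase (lower_points (embed_interval I)) (upper_point (embed_interval I))"
    and "u \<in> lower_points (embed_interval I) \<Longrightarrow> u \<le> upper_point (embed_interval I)"
proof -
  have min_max: "minimal_points I = lower_points (embed_interval I) \<and>
    maximal_points I = {upper_point (embed_interval I)}"
    using assms unfolding small_interval_def
  proof
    assume I: "pq_interval 1 1 I"
    obtain a b X Y where m: "minimal_points I = {(a, b)}" "maximal_points I = {(X, Y)}"
      using pq_interval_11_cases[OF I] .
    show ?thesis
      unfolding embed_interval_11[OF I m] lower_points_def upper_point_def vector_6 m by simp
  next
    assume I: "pq_interval 2 1 I"
    obtain a b c d X Y where m: "minimal_points I = {(a, b), (c, d)}" "a < c" "b > d"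
      "maximal_points I = {(X, Y)}"
      using pq_interval_21_cases[OF I] .
    show ?thesis
      unfolding embed_interval_21[OF I m] lower_points_def upper_point_def vector_6 m by simp
  qed
  have span: "I = {z. \<exists>u\<in>minimal_points I. \<exists>v\<in>maximal_points I. u \<le> z \<and> z \<le> v}"
    using assms unfolding small_interval_def pq_interval_def by blast
  then show I: "I = staircase (lower_points (embed_interval I)) (upper_point (embed_interval I))"
    using min_max unfolding staircase_def by auto
  show "u \<le> upper_point (embed_interval I)" if "u \<in> lower_points (embed_interval I)"
  proof -
    have "u \<in> I"
      using that min_max by (auto simp: minimal_points_def)
    then show ?thesis
      by (subst (asm) I) (auto simp: staircase_def)
  qed
qed

definition vectors_close :: "real \<Rightarrow> real ^ 6 \<Rightarrow> real ^ 6 \<Rightarrow> bool" where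
  "vectors_close \<epsilon> v w \<longleftrightarrow>
     (\<forall>q\<in>lower_points w. \<exists>p\<in>lower_points v. le_upto \<epsilon> p q) \<and>
     (\<forall>p\<in>lower_points v. \<exists>q\<in>lower_points w. le_upto \<epsilon> q p) \<and>
     le_upto \<epsilon> (upper_point w) (upper_point v) \<and> le_upto \<epsilon> (upper_point v) (upper_point w)"

lemma vectors_close_iff:
  assumes "0 \<le> \<epsilon>" "small_interval I" "small_interval J"
  shows "J \<subseteq> thickening \<epsilon> I \<and> I \<subseteq> thickening \<epsilon> J \<longleftrightarrow>
    vectors_close \<epsilon> (embed_interval I) (embed_interval J)"
proof -
  have ne: "lower_points v \<noteq> {}" for v
    by (simp add: lower_points_def)
  let ?I = "embed_interval I" and ?J = "embed_interval J"
  have sub: "staircase (lower_points (embed_interval B)) (upper_point (embed_interval B))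
      \<subseteq> thickening \<epsilon> (staircase (lower_points (embed_interval A)) (upper_point (embed_interval A)))
    \<longleftrightarrow> (\<forall>q\<in>lower_points (embed_interval B). \<exists>p\<in>lower_points (embed_interval A). le_upto \<epsilon> p q) \<and>
      le_upto \<epsilon> (upper_point (embed_interval B)) (upper_point (embed_interval A))"
    if "small_interval A" "small_interval B" for A B
    by (rule staircase_subset_thickening_iff)
      (fact assms(1), erule small_interval_shape(2)[OF that(1)],
        erule small_interval_shape(2)[OF that(2)], rule ne)
  have "staircase (lower_points ?J) (upper_point ?J)
      \<subseteq> thickening \<epsilon> (staircase (lower_points ?I) (upper_point ?I)) \<and>
    staircase (lower_points ?I) (upper_point ?I)
      \<subseteq> thickening \<epsilon> (staircase (lower_points ?J) (upper_point ?J)) \<longleftrightarrow> vectors_close \<epsilon> ?I ?J"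
    unfolding vectors_close_def sub[OF assms(2,3)] sub[OF assms(3,2)] by argo
  then show ?thesis
    unfolding small_interval_shape(1)[OF assms(2), symmetric]
      small_interval_shape(1)[OF assms(3), symmetric] .
qed

section \<open>The threshold of the correspondence distance\<close>

text \<open>
  Among the correspondences for a given \<open>\<epsilon>\<close> there is a largest candidate, namely the set of all
  pairs that satisfy the containments, so only the surjectivity of its projections matters.
\<close>

lemma ex_eps_correspondence_iff:
  "(\<exists>R. eps_correspondence \<epsilon> \<I> \<J> R) \<longleftrightarrow>
     (\<forall>I\<in>\<I>. \<exists>J\<in>\<J>. J \<subseteq> thickening \<epsilon> I \<and> I \<subseteq> thickening \<epsilon> J) \<and>
     (\<forall>J\<in>\<J>. \<exists>I\<in>\<I>. J \<subseteq> thickening \<epsilon> I \<and> I \<subseteq> thickening \<epsilon> J)"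
  (is "?L \<longleftrightarrow> ?R")
proof
  assume ?L
  then obtain R where R: "eps_correspondence \<epsilon> \<I> \<J> R"
    by blast
  then have mem: "fst x \<in> \<I> \<and> snd x \<in> \<J> \<and> snd x \<subseteq> thickening \<epsilon> (fst x) \<and>
      fst x \<subseteq> thickening \<epsilon> (snd x)" if "x \<in> R" for x
    using that unfolding eps_correspondence_def by (cases x) auto
  have proj: "fst ` R = \<I>" "snd ` R = \<J>"
    using R unfolding eps_correspondence_def by simp_all
  show ?R
  proof (intro conjI ballI)
    fix I assume "I \<in> \<I>"
    then obtain x where x: "x \<in> R" "I = fst x"
      using proj(1) by auto
    then show "\<exists>J\<in>\<J>. J \<subseteq> thickening \<epsilon> I \<and> I \<subseteq> thickening \<epsilon> J"
      using mem[OF x(1)] by blast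
  next
    fix J assume "J \<in> \<J>"
    then obtain x where x: "x \<in> R" "J = snd x"
      using proj(2) by auto
    then show "\<exists>I\<in>\<I>. J \<subseteq> thickening \<epsilon> I \<and> I \<subseteq> thickening \<epsilon> J"
      using mem[OF x(1)] by blast
  qed
next
  assume R: ?R
  define S where
    "S = {(I, J). I \<in> \<I> \<and> J \<in> \<J> \<and> J \<subseteq> thickening \<epsilon> I \<and> I \<subseteq> thickening \<epsilon> J}"
  have "fst ` S = \<I>"
  proof
    show "fst ` S \<subseteq> \<I>"
      unfolding S_def by auto
    show "\<I> \<subseteq> fst ` S"
    proof
      fix I assume "I \<in> \<I>"
      with R obtain J where "(I, J) \<in> S"
        unfolding S_def by blast
      then show "I \<in> fst ` S"
        by (rule image_eqI[rotated]) simp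
    qed
  qed
  moreover have "snd ` S = \<J>"
  proof
    show "snd ` S \<subseteq> \<J>"
      unfolding S_def by auto
    show "\<J> \<subseteq> snd ` S"
    proof
      fix J assume "J \<in> \<J>"
      with R obtain I where "(I, J) \<in> S"
        unfolding S_def by blast
      then show "J \<in> snd ` S"
        by (rule image_eqI[rotated]) simp
    qed
  qed
  moreover have "S \<subseteq> \<I> \<times> \<J>" "\<forall>(I, J)\<in>S. J \<subseteq> thickening \<epsilon> I \<and> I \<subseteq> thickening \<epsilon> J"
    unfolding S_def by blast+
  ultimately have "eps_correspondence \<epsilon> \<I> \<J> S"
    unfolding eps_correspondence_def by simp
  then show ?L ..
qed

definition block :: "'m \<Rightarrow> real ^ ('m::finite \<times> 6) \<Rightarrow> real ^ 6" where
  "block i v = (\<chi> k. v $ (i, k))"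

lemma block_embed_tuple: "block i (embed_tuple J) = embed_interval (J i)"
  by (simp add: block_def embed_tuple_def vec_eq_iff)

lemma affine_threshold_vectors_close:
  "affine_threshold (\<lambda>v \<epsilon>. vectors_close \<epsilon> u (block i v))"
  unfolding vectors_close_def lower_points_def upper_point_def le_upto_def block_def
  by (simp, intro affine_threshold_conj affine_threshold_disj affine_threshold_le
      piecewise_affine_diff piecewise_affine_add piecewise_affine_nth piecewise_affine_const)

lemma Inf_positive_threshold: "Inf {\<epsilon>::real. \<epsilon> > 0 \<and> s \<le> \<epsilon>} = max 0 s"
proof (cases "s > 0")
  case True
  then have "{\<epsilon>. \<epsilon> > 0 \<and> s \<le> \<epsilon>} = {s..}"
    by auto
  with True show ?thesis
    by simp
next
  case False
  then have "{\<epsilon>. \<epsilon> > 0 \<and> s \<le> \<epsilon>} = {0<..}"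
    by auto
  with False show ?thesis
    by simp
qed

lemma dhat_piecewise_affine:
  fixes \<I> :: "plane set set"
  assumes "finite \<I>" "\<I> \<noteq> {}" "\<And>I. I \<in> \<I> \<Longrightarrow> small_interval I"
  obtains g :: "real ^ ('m::finite \<times> 6) \<Rightarrow> real" where "piecewise_affine g"
    "\<And>J. J \<in> interval_tuples \<Longrightarrow> dhat \<I> (range J) = g (embed_tuple J)"
proof -
  define P where "P v \<epsilon> \<longleftrightarrow>
      (\<forall>I\<in>\<I>. \<exists>i\<in>UNIV. vectors_close \<epsilon> (embed_interval I) (block i v)) \<and>
      (\<forall>i\<in>UNIV. \<exists>I\<in>\<I>. vectors_close \<epsilon> (embed_interval I) (block i v))"
    for v :: "real ^ ('m \<times> 6)" and \<epsilon>
  have "affine_threshold P"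
    unfolding P_def using assms(1,2)
    by (intro affine_threshold_conj affine_threshold_ball affine_threshold_bex
        affine_threshold_vectors_close) auto
  then obtain f where f: "piecewise_affine f" "\<And>v \<epsilon>. P v \<epsilon> \<longleftrightarrow> f v \<le> \<epsilon>"
    unfolding affine_threshold_def by blast
  have "dhat \<I> (range J) = max 0 (f (embed_tuple J))" if J: "J \<in> interval_tuples" for J
  proof -
    have "(\<exists>R. eps_correspondence \<epsilon> \<I> (range J) R) \<longleftrightarrow> f (embed_tuple J) \<le> \<epsilon>" if "\<epsilon> > 0" for \<epsilon>
    proof -
      have "J i \<subseteq> thickening \<epsilon> I \<and> I \<subseteq> thickening \<epsilon> (J i) \<longleftrightarrow>
          vectors_close \<epsilon> (embed_interval I) (block i (embed_tuple J))" if "I \<in> \<I>" for I i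
        using vectors_close_iff[of \<epsilon> I "J i"] that \<open>\<epsilon> > 0\<close> J assms(3)
        by (simp add: block_embed_tuple interval_tuples_def)
      then have "(\<exists>R. eps_correspondence \<epsilon> \<I> (range J) R) \<longleftrightarrow> P (embed_tuple J) \<epsilon>"
        unfolding ex_eps_correspondence_iff P_def by (simp cong: ball_cong bex_cong)
      then show ?thesis
        by (simp add: f(2))
    qed
    then have "dhat \<I> (range J) = Inf {\<epsilon>. \<epsilon> > 0 \<and> f (embed_tuple J) \<le> \<epsilon>}"
      unfolding dhat_def by (intro arg_cong[of _ _ Inf]) auto
    then show ?thesis
      by (simp add: Inf_positive_threshold)
  qed
  then show thesis
    using that[of "\<lambda>v. max 0 (f v)"] f(1)
    by (simp add: piecewise_affine_max piecewise_affine_const)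
qed

theorem proposition16:
  fixes t :: nat and \<I> :: "plane set set"
  assumes "t > 0"
    and "finite \<I>" and "\<I> \<noteq> {}"
    and "\<forall>I\<in>\<I>. pq_interval 1 1 I \<or> pq_interval 2 1 I"
  shows "AE v in lebesgue. v \<in> (loss_domain :: (real ^ ('m::finite \<times> 6)) set) \<longrightarrow>
           loss t \<I> differentiable (at v within loss_domain)"
proof -
  obtain g :: "real ^ ('m \<times> 6) \<Rightarrow> real" where g: "piecewise_affine g"
    "\<And>J. J \<in> interval_tuples \<Longrightarrow> dhat \<I> (range J) = g (embed_tuple J)"
    using dhat_piecewise_affine[OF assms(2,3)] assms(4) unfolding small_interval_def by blast
  have loss: "loss t \<I> w = real t * g w" if "w \<in> loss_domain" for w :: "real ^ ('m \<times> 6)"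
    using that g(2) by (auto simp: loss_domain_def loss_embed_tuple)
  from piecewise_affine_AE_differentiable[OF g(1)] show ?thesis
  proof eventually_elim
    case (elim v)
    then have diff: "(\<lambda>w. real t * g w) differentiable (at v within loss_domain)"
      by (intro differentiable_mult differentiable_const) (rule differentiable_at_withinI)
    show ?case
    proof
      assume v: "v \<in> loss_domain"
      show "loss t \<I> differentiable (at v within loss_domain)"
        by (rule differentiable_transform_within[OF diff zero_less_one v]) (simp add: loss)
    qed
  qed
qed

end
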